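(* Let $\mathscr{U},\mathscr{V},\mathscr{T}$ be separable real Hilbert spaces, let $G:\mathscr{U}\supset \mathrm{dom}(G)\to \mathscr{V}'$ be a differentiable mapping, and let $G=G_0+G_1G_2$ with $G_1\in\mathcal{L}(\mathscr{T},\mathscr{V}')$ and $G_2\in\mathcal{L}(\mathscr{U},\mathscr{T})$. Define $\vec H:\mathscr{U}\times\mathscr{T}\supset \mathrm{dom}(G)\times\mathscr{T}\to\mathscr{V}'\times\mathscr{T}$ by $\vec H(u,\theta):=(G_0(u)+G_1\theta,\ \theta-G_2u)$. Let $DG(u)\in\mathcal{L}(\mathscr{U},\mathscr{V}')$ be a homeomorphism with its range, i.e. $\|DG(u)v\|_{\mathscr{V}'}\eqsim\|v\|_{\mathscr{U}}$ $(v\in\mathscr{U})$. Then $$D\vec H(u,\theta)=\begin{bmatrix} DG_0(u) & G_1\\ -G_2 & I\end{bmatrix}\in\mathcal{L}(\mathscr{U}\times\mathscr{T},\mathscr{V}'\times\mathscr{T})$$ is a homeomorphism with its range, and this range is $\{(f,g)\in\mathscr{V}'\times\mathscr{T}: f-G_1g\in\operatorname{ran}DG(u)\}$. In particular, with $r,R>0$ such that $r\|v\|_{\mathscr{U}}\le\|DG(u)v\|_{\mathscr{V}'}\le R\|v\|_{\mathscr{U}}$ for all $v\in\mathscr{U}$, it holds for all $(v,\eta)\in\mathscr{U}\times\mathscr{T}$ that $$\|(v,\eta)\|_{\mathscr{U}\times\mathscr{T}}^2\le\Big[\Big(\tfrac{1+\|G_2\|}{r}\Big)^2+\Big(1+\tfrac{1+\|G_1\|(1+\|G_2\|)}{r}\Big)^2\Big]\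 \Big\|D\vec H(u,\theta)\begin{bmatrix}v\\ \eta\end{bmatrix}\Big\|^2_{\mathscr{V}'\times\mathscr{T}},$$ $$\Big\|D\vec H(u,\theta)\begin{bmatrix}v\\ \eta\end{bmatrix}\Big\|^2_{\mathscr{V}'\times\mathscr{T}}\le\Big(\big(R+(1+\|G_1\|)\|G_2\|\big)^2+(1+\|G_1\|)^2\Big)\,\|(v,\eta)\|^2_{\mathscr{U}\times\mathscr{T}}.$$
   Context: $\mathcal{L}(X,Y)$ is the space of bounded linear maps $X\to Y$, a prime on a space denotes its dual, and $\|G_1\|,\|G_2\|$ are operator norms. Product spaces carry the Hilbertian product norm, $\|(v,\eta)\|^2_{\mathscr{U}\times\mathscr{T}}=\|v\|^2_{\mathscr{U}}+\|\eta\|^2_{\mathscr{T}}$, and similarly for $\mathscr{V}'\times\mathscr{T}$. $DG$, $DG_0$, $D\vec H$ are Fréchet derivatives; $u\in\mathrm{dom}(G)$ is a point at which $G$ is differentiable, and $\theta\in\mathscr{T}$. A bounded linear map $L:X\to Y$ is called a homeomorphism with its range when $\|Lx\|_Y\eqsim\|x\|_X$ for $x\in X$; $a\eqsim b$ means that each quantity is bounded by a constant multiple of the other. *)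

theory Defs
  imports "HOL-Analysis.Analysis"
begin

text \<open>
  The dual of a real normed space is the space of bounded linear functionals with the
  operator norm; the norm of a product type is already the Hilbertian one.
\<close>

type_synonym 'a dual = "'a \<Rightarrow>\<^sub>L real"

text \<open>
  Mappings with a domain \<open>S\<close> are total functions whose values outside \<open>S\<close> are irrelevant.
  The derivative relative to \<open>S\<close> is unique, hence meaningful, at interior points of \<open>S\<close>.
\<close>

abbreviation frechet_deriv_on ::
    "'a::real_normed_vector set \<Rightarrow> ('a \<Rightarrow> 'b::real_normed_vector) \<Rightarrow> 'a \<Rightarrow> 'a \<Rightarrow> 'b"
  where "frechet_deriv_on S f x \<equiv> frechet_derivative f (at x within S)"

definition eqsim :: "('a \<Rightarrow> real) \<Rightarrow> ('a \<Rightarrow> real) \<Rightarrow> bool"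
  where "eqsim a b \<longleftrightarrow>
    (\<exists>C>0. \<forall>x. a x \<le> C * b x) \<and> (\<exists>C>0. \<forall>x. b x \<le> C * a x)"

definition homeomorphism_with_range ::
    "('a::real_normed_vector \<Rightarrow> 'b::real_normed_vector) \<Rightarrow> bool"
  where "homeomorphism_with_range L \<longleftrightarrow>
    bounded_linear L \<and> eqsim (\<lambda>x. norm (L x)) (\<lambda>x. norm x)"

definition H_vec ::
    "('u::real_normed_vector \<Rightarrow> 'w::real_normed_vector) \<Rightarrow> ('t::real_normed_vector \<Rightarrow>\<^sub>L 'w) \<Rightarrow>
     ('u \<Rightarrow>\<^sub>L 't) \<Rightarrow> 'u \<times> 't \<Rightarrow> 'w \<times> 't"
  where "H_vec G0 G1 G2 = (\<lambda>(u, \<theta>). (G0 u + blinfun_apply G1 \<theta>, \<theta> - blinfun_apply G2 u))"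

text \<open>The operator matrix with rows \<open>(A, B)\<close> and \<open>(C, D)\<close>.\<close>

definition block_op ::
    "('a \<Rightarrow> 'c::plus) \<Rightarrow> ('b \<Rightarrow> 'c) \<Rightarrow> ('a \<Rightarrow> 'd::plus) \<Rightarrow> ('b \<Rightarrow> 'd) \<Rightarrow> 'a \<times> 'b \<Rightarrow> 'c \<times> 'd"
  where "block_op A B C D = (\<lambda>(v, \<eta>). (A v + B \<eta>, C v + D \<eta>))"

end

theory Submission
  imports Defs
begin

text \<open>
  Write \<open>(f, g)\<close> for the image of \<open>(v, \<eta>)\<close> under the operator matrix. Then
  \<open>f - G1 g = DG(u) v\<close> and \<open>\<eta> = g + G2 v\<close>. This block elimination gives the range and, with
  \<open>a = \<parallel>G1\<parallel>\<close>, \<open>b = \<parallel>G2\<parallel>\<close>,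
  \<open>\<parallel>v\<parallel> \<le> (\<parallel>f\<parallel> + a \<parallel>g\<parallel>) / r\<close> and \<open>\<parallel>\<eta>\<parallel> \<le> b/r \<parallel>f\<parallel> + (1 + a b / r) \<parallel>g\<parallel>\<close>.
  The constants in the theorem dominate the squared Frobenius norms of the
  \<open>2 \<times> 2\<close> matrices of coefficients in these bounds and in their analogues for \<open>(f, g)\<close>.
\<close>

text \<open>Cauchy-Schwarz in the plane: the two sides of the squared inequality differ by the
  square of \<open>a * y - b * x\<close>.\<close>

lemma lincomb_square_le:
  fixes a b x y z :: real
  assumes "0 \<le> z" "z \<le> a * x + b * y"
  shows "z\<^sup>2 \<le> (a\<^sup>2 + b\<^sup>2) * (x\<^sup>2 + y\<^sup>2)"
proof -
  have "z\<^sup>2 \<le> (a * x + b * y)\<^sup>2"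
    using assms by (intro power_mono) auto
  also have "\<dots> \<le> (a\<^sup>2 + b\<^sup>2) * (x\<^sup>2 + y\<^sup>2)"
    using zero_le_power2[of "a * y - b * x"] by (simp add: power2_eq_square algebra_simps)
  finally show ?thesis .
qed

lemma norm_Pair_square: "(norm (x, y))\<^sup>2 = (norm x)\<^sup>2 + (norm y)\<^sup>2"
  by (simp add: norm_Pair)

text \<open>Cauchy-Schwarz, applied to each row of the coefficient matrix, bounds its operator norm
  by its Frobenius norm. The slack \<open>K\<close> lets the constants of the theorem enter
  directly.\<close>

lemma norm_Pair_square_le:
  assumes "norm x \<le> a * s + b * t" "norm y \<le> c * s + d * t"
    and "a\<^sup>2 + b\<^sup>2 + (c\<^sup>2 + d\<^sup>2) \<le> K"
  shows "(norm (x, y))\<^sup>2 \<le> K * (s\<^sup>2 + t\<^sup>2)"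
proof -
  have "(norm (x, y))\<^sup>2 \<le> (a\<^sup>2 + b\<^sup>2 + (c\<^sup>2 + d\<^sup>2)) * (s\<^sup>2 + t\<^sup>2)"
    using lincomb_square_le[OF norm_ge_zero assms(1)] lincomb_square_le[OF norm_ge_zero assms(2)]
    by (simp add: norm_Pair_square distrib_right)
  also have "\<dots> \<le> K * (s\<^sup>2 + t\<^sup>2)"
    using assms(3) by (intro mult_right_mono) auto
  finally show ?thesis .
qed

text \<open>The upper left entry is \<open>A - B C\<close> because \<open>A\<close> stands for the
  derivative of G, and G0 is G minus the product of \<open>B\<close> and \<open>C\<close>.\<close>

lemma block_lower_bound:
  fixes B :: "'t::real_normed_vector \<Rightarrow>\<^sub>L 'w::real_normed_vector"
    and C :: "'u::real_normed_vector \<Rightarrow>\<^sub>L 't"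
  assumes r: "r > 0" and low: "r * norm v \<le> norm (A v)"
  shows "(norm (v, \<eta>))\<^sup>2 \<le>
    (((1 + norm C) / r)\<^sup>2 + (1 + (1 + norm B * (1 + norm C)) / r)\<^sup>2) *
    (norm (block_op (\<lambda>v. A v - B (C v)) B (\<lambda>v. - C v) (\<lambda>\<eta>. \<eta>) (v, \<eta>)))\<^sup>2"
proof -
  define f where "f = A v - B (C v) + B \<eta>"
  define g where "g = \<eta> - C v"
  let ?a = "norm B" and ?b = "norm C"
  have "A v = f - B g"
    by (simp add: f_def g_def blinfun.diff_right)
  then have "r * norm v \<le> norm f + norm (B g)"
    using low norm_triangle_ineq4[of f "B g"] by simp
  then have "r * norm v \<le> norm f + ?a * norm g"
    using norm_blinfun[of B g] by simp
  then have v: "norm v \<le> 1 / r * norm f + ?a / r * norm g"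
    using r by (simp add: field_simps)
  have "\<eta> = g + C v"
    by (simp add: g_def)
  then have "norm \<eta> \<le> norm g + norm (C v)"
    using norm_triangle_ineq by metis
  also have "\<dots> \<le> norm g + ?b * norm v"
    using norm_blinfun[of C v] by simp
  also have "\<dots> \<le> norm g + ?b * (1 / r * norm f + ?a / r * norm g)"
    using v by (intro add_left_mono mult_left_mono) auto
  finally have \<eta>: "norm \<eta> \<le> ?b / r * norm f + (1 + ?a * ?b / r) * norm g"
    by (simp add: algebra_simps)
  \<comment> \<open>With \<open>p\<close> for the reciprocal of \<open>r\<close>, comparing the
    constants becomes a polynomial matter: their difference has only nonnegative coefficients in
    \<open>norm B\<close>, \<open>norm C\<close> and \<open>p\<close>.\<close>
  define p where "p = 1 / r"
  have p: "p \<ge> 0" using r by (simp add: p_def)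
  have *: "(p * (1 + ?b))\<^sup>2 + (1 + p * (1 + ?a * (1 + ?b)))\<^sup>2 =
      (p\<^sup>2 + (?a * p)\<^sup>2 + ((?b * p)\<^sup>2 + (1 + ?a * ?b * p)\<^sup>2)) +
      (2 * ?b * p\<^sup>2 + 2 * p + 2 * ?a * p + p\<^sup>2 + 2 * ?a * p\<^sup>2 + 2 * ?a * ?b * p\<^sup>2
        + 2 * ?a\<^sup>2 * ?b * p\<^sup>2)"
    by (simp add: power2_eq_square algebra_simps)
  have "0 \<le> 2 * ?b * p\<^sup>2 + 2 * p + 2 * ?a * p + p\<^sup>2 + 2 * ?a * p\<^sup>2 + 2 * ?a * ?b * p\<^sup>2
        + 2 * ?a\<^sup>2 * ?b * p\<^sup>2"
    using p by simp
  with * have "p\<^sup>2 + (?a * p)\<^sup>2 + ((?b * p)\<^sup>2 + (1 + ?a * ?b * p)\<^sup>2) \<le>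
      (p * (1 + ?b))\<^sup>2 + (1 + p * (1 + ?a * (1 + ?b)))\<^sup>2"
    by linarith
  then have K: "(1 / r)\<^sup>2 + (?a / r)\<^sup>2 + ((?b / r)\<^sup>2 + (1 + ?a * ?b / r)\<^sup>2) \<le>
      ((1 + ?b) / r)\<^sup>2 + (1 + (1 + ?a * (1 + ?b)) / r)\<^sup>2"
    by (simp add: p_def)
  have "block_op (\<lambda>v. A v - B (C v)) B (\<lambda>v. - C v) (\<lambda>\<eta>. \<eta>) (v, \<eta>) = (f, g)"
    by (simp add: block_op_def f_def g_def)
  with norm_Pair_square_le[OF v \<eta> K] show ?thesis
    by (simp add: norm_Pair_square)
qed

lemma block_upper_bound:
  fixes B :: "'t::real_normed_vector \<Rightarrow>\<^sub>L 'w::real_normed_vector"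
    and C :: "'u::real_normed_vector \<Rightarrow>\<^sub>L 't"
  assumes R: "R > 0" and up: "norm (A v) \<le> R * norm v"
  shows "(norm (block_op (\<lambda>v. A v - B (C v)) B (\<lambda>v. - C v) (\<lambda>\<eta>. \<eta>) (v, \<eta>)))\<^sup>2 \<le>
    ((R + (1 + norm B) * norm C)\<^sup>2 + (1 + norm B)\<^sup>2) * (norm (v, \<eta>))\<^sup>2"
proof -
  let ?a = "norm B" and ?b = "norm C"
  have Cv: "norm (C v) \<le> ?b * norm v"
    by (rule norm_blinfun)
  have "norm (B (C v)) \<le> ?a * norm (C v)"
    by (rule norm_blinfun)
  also have "\<dots> \<le> ?a * (?b * norm v)"
    using Cv by (intro mult_left_mono) auto
  finally have BC: "norm (B (C v)) \<le> ?a * ?b * norm v"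
    by simp
  have "norm (A v - B (C v) + B \<eta>) \<le> norm (A v) + norm (B (C v)) + norm (B \<eta>)"
    using norm_triangle_ineq[of "A v - B (C v)" "B \<eta>"] norm_triangle_ineq4[of "A v" "B (C v)"]
    by linarith
  then have f: "norm (A v - B (C v) + B \<eta>) \<le> (R + ?a * ?b) * norm v + ?a * norm \<eta>"
    using up BC norm_blinfun[of B \<eta>] by (simp add: distrib_right)
  have g: "norm (- C v + \<eta>) \<le> ?b * norm v + 1 * norm \<eta>"
    using norm_triangle_ineq[of "- C v" \<eta>] Cv by simp
  \<comment> \<open>The first bracket on the right is the squared Frobenius norm of the coefficients
    in \<open>f\<close> and \<open>g\<close>; the second is the nonnegative surplus.\<close>
  have *: "(R + (1 + ?a) * ?b)\<^sup>2 + (1 + ?a)\<^sup>2 =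
      ((R + ?a * ?b)\<^sup>2 + ?a\<^sup>2 + (?b\<^sup>2 + 1\<^sup>2)) + (2 * R * ?b + 2 * ?a * ?b\<^sup>2 + 2 * ?a)"
    by (simp add: power2_eq_square algebra_simps)
  have "0 \<le> 2 * R * ?b + 2 * ?a * ?b\<^sup>2 + 2 * ?a"
    using R by simp
  with * have "(R + ?a * ?b)\<^sup>2 + ?a\<^sup>2 + (?b\<^sup>2 + 1\<^sup>2) \<le> (R + (1 + ?a) * ?b)\<^sup>2 + (1 + ?a)\<^sup>2"
    by linarith
  from norm_Pair_square_le[OF f g this] show ?thesis
    by (simp add: block_op_def norm_Pair_square)
qed

lemma range_block_op:
  fixes B :: "'t::real_normed_vector \<Rightarrow>\<^sub>L 'w::real_normed_vector"
    and C :: "'u::real_normed_vector \<Rightarrow>\<^sub>L 't"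
  shows "range (block_op (\<lambda>v. A v - B (C v)) B (\<lambda>v. - C v) (\<lambda>\<eta>. \<eta>)) =
    {(f, g). f - B g \<in> range A}" (is "range ?L = ?S")
proof
  show "range ?L \<subseteq> ?S"
    by (auto simp: block_op_def blinfun.bilinear_simps)
  show "?S \<subseteq> range ?L"
  proof safe
    fix f g v assume "f - B g = A v"
    \<comment> \<open>The second component of the preimage is found by solving the second row for
      it.\<close>
    then have "(f, g) = ?L (v, g + C v)"
      by (simp add: block_op_def blinfun.bilinear_simps algebra_simps)
    then show "(f, g) \<in> range ?L"
      by blast
  qed
qed

lemma homeomorphism_with_rangeI:
  assumes "bounded_linear L"
    and low: "\<And>x. (norm x)\<^sup>2 \<le> K * (norm (L x))\<^sup>2"
    and up: "\<And>x. (norm (L x))\<^sup>2 \<le> M * (norm x)\<^sup>2"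
  shows "homeomorphism_with_range L"
proof -
  \<comment> \<open>The absolute value covers a \<open>c\<close> of unknown sign; adding 1 makes the
    constant strictly positive, as \<open>eqsim\<close> demands.\<close>
  have root: "s \<le> (sqrt \<bar>c\<bar> + 1) * t" if "s\<^sup>2 \<le> c * t\<^sup>2" "0 \<le> t" for s t c :: real
  proof -
    have "s\<^sup>2 \<le> \<bar>c\<bar> * t\<^sup>2"
      using that(1) by (rule order_trans) (intro mult_right_mono, auto)
    then have "s\<^sup>2 \<le> (sqrt \<bar>c\<bar> * t)\<^sup>2"
      by (simp add: power_mult_distrib)
    then have "s \<le> sqrt \<bar>c\<bar> * t"
      using that(2) by (intro power2_le_imp_le[of s]) auto
    with that(2) show ?thesis
      by (simp add: distrib_right)
  qed
  have "0 < sqrt \<bar>c\<bar> + 1" for c :: real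
    by (simp add: add_nonneg_pos)
  then show ?thesis
    unfolding homeomorphism_with_range_def eqsim_def
    using assms(1) root[OF low norm_ge_zero] root[OF up norm_ge_zero] by blast
qed

lemma homeomorphism_with_rangeD:
  assumes "homeomorphism_with_range L"
  obtains r R where "r > 0" "R > 0" "\<And>x. r * norm x \<le> norm (L x)" "\<And>x. norm (L x) \<le> R * norm x"
proof -
  from assms obtain C R where C: "C > 0" "\<And>x. norm x \<le> C * norm (L x)"
    and R: "R > 0" "\<And>x. norm (L x) \<le> R * norm x"
    unfolding homeomorphism_with_range_def eqsim_def by blast
  have "1 / C * norm x \<le> norm (L x)" for x
    using C by (simp add: field_simps)
  with C(1) R show ?thesis
    using that[of "1 / C" R] by simp
qed

text \<open>At an interior point the restricted filter is the full one, where derivatives are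
  unique, so the choice made by \<open>frechet_derivative\<close> must be \<open>f'\<close>.\<close>

lemma frechet_derivative_within_interior:
  assumes "(f has_derivative f') (at x within S)" "x \<in> interior S"
  shows "frechet_derivative f (at x within S) = f'"
  using assms by (metis at_within_interior frechet_derivative_at)

lemma has_derivative_H_vec:
  assumes "(G0 has_derivative D) (at u within S)"
  shows "(H_vec G0 G1 G2 has_derivative block_op D (blinfun_apply G1) (\<lambda>v. - G2 v) (\<lambda>\<eta>. \<eta>))
    (at (u, \<theta>) within S \<times> UNIV)"
proof -
  have "(fst has_derivative fst) (at (u, \<theta>) within S \<times> UNIV)"
    by (rule has_derivative_fst[OF has_derivative_ident])
  \<comment> \<open>The chain rule asks for the derivative of \<open>G0\<close> relative to the
    image of the product domain under \<open>fst\<close>.\<close>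
  moreover have "fst ` (S \<times> (UNIV :: 'c set)) = S"
    by auto
  ultimately have "((\<lambda>p. G0 (fst p)) has_derivative (\<lambda>p. D (fst p))) (at (u, \<theta>) within S \<times> UNIV)"
    using has_derivative_in_compose[of fst fst "(u, \<theta>)" "S \<times> UNIV" G0 D] assms by simp
  then have "((\<lambda>p. (G0 (fst p) + G1 (snd p), snd p - G2 (fst p))) has_derivative
      (\<lambda>p. (D (fst p) + G1 (snd p), snd p - G2 (fst p)))) (at (u, \<theta>) within S \<times> UNIV)"
    by (auto intro!: derivative_eq_intros)
  then show ?thesis
    by (simp add: H_vec_def block_op_def case_prod_beta')
qed

theorem lemma2p3:
  fixes domG :: "'u::{real_inner, complete_space} set"
    and G G0 :: "'u \<Rightarrow> 'v::{real_inner, complete_space} dual"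
    and G1 :: "'t::{real_inner, complete_space} \<Rightarrow>\<^sub>L 'v dual"
    and G2 :: "'u \<Rightarrow>\<^sub>L 't"
    and u :: 'u and \<theta> :: 't
  assumes "separable_space (euclidean :: 'u topology)"
    and "separable_space (euclidean :: 'v topology)"
    and "separable_space (euclidean :: 't topology)"
    and "u \<in> interior domG"
    and "G differentiable (at u within domG)"
    and "\<And>w. w \<in> domG \<Longrightarrow> G w = G0 w + blinfun_apply G1 (blinfun_apply G2 w)"
    and "homeomorphism_with_range (frechet_deriv_on domG G u)"
  shows "G0 differentiable (at u within domG) \<and>
         H_vec G0 G1 G2 differentiable (at (u, \<theta>) within domG \<times> UNIV) \<and>
         frechet_deriv_on (domG \<times> UNIV) (H_vec G0 G1 G2) (u, \<theta>) =
           block_op (frechet_deriv_on domG G0 u) (blinfun_apply G1)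
                    (\<lambda>v. - blinfun_apply G2 v) (\<lambda>\<eta>. \<eta>) \<and>
         homeomorphism_with_range (frechet_deriv_on (domG \<times> UNIV) (H_vec G0 G1 G2) (u, \<theta>)) \<and>
         range (frechet_deriv_on (domG \<times> UNIV) (H_vec G0 G1 G2) (u, \<theta>)) =
           {(f, g). f - blinfun_apply G1 g \<in> range (frechet_deriv_on domG G u)} \<and>
         (\<forall>r R. r > 0 \<and> R > 0 \<and>
           (\<forall>v. r * norm v \<le> norm (frechet_deriv_on domG G u v) \<and>
                norm (frechet_deriv_on domG G u v) \<le> R * norm v) \<longrightarrow>
           (\<forall>v \<eta>.
             (norm (v, \<eta>))\<^sup>2 \<le>
               (((1 + norm G2) / r)\<^sup>2 + (1 + (1 + norm G1 * (1 + norm G2)) / r)\<^sup>2) *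
               (norm (frechet_deriv_on (domG \<times> UNIV) (H_vec G0 G1 G2) (u, \<theta>) (v, \<eta>)))\<^sup>2 \<and>
             (norm (frechet_deriv_on (domG \<times> UNIV) (H_vec G0 G1 G2) (u, \<theta>) (v, \<eta>)))\<^sup>2 \<le>
               ((R + (1 + norm G1) * norm G2)\<^sup>2 + (1 + norm G1)\<^sup>2) * (norm (v, \<eta>))\<^sup>2))"
proof -
  let ?A = "frechet_deriv_on domG G u"
  let ?L = "block_op (\<lambda>v. ?A v - G1 (G2 v)) (blinfun_apply G1) (\<lambda>v. - G2 v) (\<lambda>\<eta>. \<eta>)"
  have u: "u \<in> domG"
    using assms(4) interior_subset by blast
  have "(G has_derivative ?A) (at u within domG)"
    using assms(5) by (simp add: frechet_derivative_works)
  then have "((\<lambda>w. G w - G1 (G2 w)) has_derivative (\<lambda>v. ?A v - G1 (G2 v))) (at u within domG)"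
    by (auto intro!: derivative_eq_intros)
  \<comment> \<open>The splitting of \<open>G\<close> is known only on \<open>domG\<close>, so the
    derivative is transferred within that set, which contains \<open>u\<close>.\<close>
  then have G0: "(G0 has_derivative (\<lambda>v. ?A v - G1 (G2 v))) (at u within domG)"
    by (rule has_derivative_transform[OF u, rotated]) (simp add: assms(6))
  then have DG0: "frechet_deriv_on domG G0 u = (\<lambda>v. ?A v - G1 (G2 v))"
    using assms(4) by (rule frechet_derivative_within_interior)
  have H: "(H_vec G0 G1 G2 has_derivative ?L) (at (u, \<theta>) within domG \<times> UNIV)"
    using G0 by (rule has_derivative_H_vec)
  moreover have "(u, \<theta>) \<in> interior (domG \<times> UNIV)"
    using assms(4) by (simp add: interior_Times)
  ultimately have DH: "frechet_deriv_on (domG \<times> UNIV) (H_vec G0 G1 G2) (u, \<theta>) = ?L"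
    by (rule frechet_derivative_within_interior)
  \<comment> \<open>One such pair yields the homeomorphism property; the final estimates, for
    arbitrary \<open>r\<close> and \<open>R\<close>, come from the same two block bounds.\<close>
  obtain r R where rR: "r > 0" "R > 0" "\<And>x. r * norm x \<le> norm (?A x)" "\<And>x. norm (?A x) \<le> R * norm x"
    using homeomorphism_with_rangeD[OF assms(7)] by blast
  have homeo: "homeomorphism_with_range ?L"
  proof (rule homeomorphism_with_rangeI)
    show "bounded_linear ?L"
      using H by (rule has_derivative_bounded_linear)
    show "(norm p)\<^sup>2 \<le> (((1 + norm G2) / r)\<^sup>2 + (1 + (1 + norm G1 * (1 + norm G2)) / r)\<^sup>2) *
        (norm (?L p))\<^sup>2" for p
      by (cases p) (simp only: block_lower_bound[where A = ?A, OF rR(1,3)])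
    show "(norm (?L p))\<^sup>2 \<le> ((R + (1 + norm G1) * norm G2)\<^sup>2 + (1 + norm G1)\<^sup>2) * (norm p)\<^sup>2" for p
      by (cases p) (simp only: block_upper_bound[where A = ?A, OF rR(2,4)])
  qed
  show ?thesis
    \<comment> \<open>Both sides of the matrix formula become \<open>?L\<close>, so that this
      conjunct closes by reflexivity.\<close>
    unfolding DH DG0
  proof (intro conjI allI impI; (elim conjE)?)
    show "G0 differentiable (at u within domG)"
      using G0 by (rule differentiableI)
    show "H_vec G0 G1 G2 differentiable (at (u, \<theta>) within domG \<times> UNIV)"
      using H by (rule differentiableI)
  qed (rule refl homeo range_block_op block_lower_bound block_upper_bound; simp)+
qed

end
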